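(* Let $R$ be an integral domain and let $\pi \in R$ be a prime element satisfying $\bigcap_{n \geq 0}\pi^n R = \{0\}$. Then the following two statements are equivalent: (1) $SL_2(R[1/\pi]) = \langle SL_2(R) \cup D(1/\pi,1)\,SL_2(R)\,D(\pi,1) \rangle$. (2) $R/\pi R$ is a Bezout domain and the canonical homomorphism $SL_2(R) \to SL_2(R/\pi R)$ is surjective.
   Context: Let $F$ be the field of fractions of $R$. For $\alpha,\beta \in F^*$, $D(\alpha,\beta) := \begin{pmatrix} \alpha & 0 \\ 0 & \beta \end{pmatrix} \in GL_2(F)$. $R[1/\pi]$ is the subring of $F$ generated by $R$ and $1/\pi$. $\langle M \rangle$ denotes the subgroup (of $SL_2(F)$) generated by $M$. A commutative ring is called Bezout if each of its finitely generated ideals is principal. *)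

theory Defs
  imports
    "HOL-Algebra.Algebra"
    "HOL-Computational_Algebra.Computational_Algebra"
    "HOL-Decision_Procs.Algebra_Aux"
begin

text \<open>
  The domain \<open>R\<close> is the type \<open>'a :: idom\<close> and its field of fractions \<open>F\<close> is the library type
  \<open>'a fract\<close>, with \<^const>\<open>to_fract\<close> as the embedding. As \<open>R[1/\<pi>]\<close> and \<open>R/\<pi>R\<close> depend on the
  element \<open>\<pi>\<close> they cannot be types, so the constructions below are on HOL-Algebra ring records;
  \<^const>\<open>cring_class_ops\<close> is the record of a type-class ring, with carrier \<open>UNIV\<close>.
\<close>

text \<open>\<open>Mat2 a b c d\<close> has rows \<open>(a, b)\<close> and \<open>(c, d)\<close>.\<close>

datatype 'a mat2 = Mat2 'a 'a 'a 'a

fun mat2_mult :: "('a, 'm) ring_scheme \<Rightarrow> 'a mat2 \<Rightarrow> 'a mat2 \<Rightarrow> 'a mat2" where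
  "mat2_mult R (Mat2 a b c d) (Mat2 a' b' c' d') =
     Mat2 (a \<otimes>\<^bsub>R\<^esub> a' \<oplus>\<^bsub>R\<^esub> b \<otimes>\<^bsub>R\<^esub> c') (a \<otimes>\<^bsub>R\<^esub> b' \<oplus>\<^bsub>R\<^esub> b \<otimes>\<^bsub>R\<^esub> d')
          (c \<otimes>\<^bsub>R\<^esub> a' \<oplus>\<^bsub>R\<^esub> d \<otimes>\<^bsub>R\<^esub> c') (c \<otimes>\<^bsub>R\<^esub> b' \<oplus>\<^bsub>R\<^esub> d \<otimes>\<^bsub>R\<^esub> d')"

fun mat2_det :: "('a, 'm) ring_scheme \<Rightarrow> 'a mat2 \<Rightarrow> 'a" where
  "mat2_det R (Mat2 a b c d) = a \<otimes>\<^bsub>R\<^esub> d \<ominus>\<^bsub>R\<^esub> b \<otimes>\<^bsub>R\<^esub> c"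

definition SL2 :: "('a, 'm) ring_scheme \<Rightarrow> 'a mat2 monoid" where
  "SL2 R = \<lparr>carrier = {A. set_mat2 A \<subseteq> carrier R \<and> mat2_det R A = \<one>\<^bsub>R\<^esub>},
            monoid.mult = mat2_mult R,
            one = Mat2 \<one>\<^bsub>R\<^esub> \<zero>\<^bsub>R\<^esub> \<zero>\<^bsub>R\<^esub> \<one>\<^bsub>R\<^esub>\<rparr>"

definition diag2 :: "'a \<Rightarrow> 'a \<Rightarrow> 'a::zero mat2" where
  "diag2 \<alpha> \<beta> = Mat2 \<alpha> 0 0 \<beta>"

definition bezout_ring :: "('a, 'm) ring_scheme \<Rightarrow> bool" where
  "bezout_ring R \<longleftrightarrow> cring R \<and>
     (\<forall>S. finite S \<and> S \<subseteq> carrier R \<longrightarrow> principalideal (Idl\<^bsub>R\<^esub> S) R)"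

definition bezout_domain :: "('a, 'm) ring_scheme \<Rightarrow> bool" where
  "bezout_domain R \<longleftrightarrow> domain R \<and> bezout_ring R"

abbreviation base_ring :: "'a::idom ring" where
  "base_ring \<equiv> cring_class_ops"

abbreviation frac_ring :: "'a::idom fract ring" where
  "frac_ring \<equiv> cring_class_ops"

definition adjoin_inverse :: "'a::idom \<Rightarrow> 'a fract ring" where
  "adjoin_inverse \<pi> =
     frac_ring\<lparr>carrier := generate_ring frac_ring (range to_fract \<union> {1 / to_fract \<pi>})\<rparr>"

definition residue_ring_at :: "'a::idom \<Rightarrow> 'a set ring" where
  "residue_ring_at \<pi> = base_ring Quot (PIdl\<^bsub>base_ring\<^esub> \<pi>)"

definition residue_class :: "'a::idom \<Rightarrow> 'a \<Rightarrow> 'a set" where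
  "residue_class \<pi> x = PIdl\<^bsub>base_ring\<^esub> \<pi> +>\<^bsub>base_ring\<^esub> x"

text \<open>\<open>SL\<^sub>2(R)\<close> as a set of matrices over \<open>F\<close>.\<close>

definition SL2_base :: "'a::idom fract mat2 set" where
  "SL2_base = map_mat2 to_fract ` carrier (SL2 base_ring)"

definition SL2_base_conj :: "'a::idom \<Rightarrow> 'a fract mat2 set" where
  "SL2_base_conj \<pi> =
     (\<lambda>A. mat2_mult frac_ring
            (mat2_mult frac_ring (diag2 (1 / to_fract \<pi>) 1) A) (diag2 (to_fract \<pi>) 1)) ` SL2_base"

end

theory Submission
  imports Defs
begin

text \<open>
  Both statements are equivalent to: \<open>SL\<^sub>2(R)\<close> acts transitively on the projective line over the
  field of fractions of \<open>R/\<pi>R\<close>, i.e. on the neighbours of a vertex in the Bruhat-Tits tree of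
  \<open>SL\<^sub>2(F)\<close> at \<open>\<pi>\<close>. For (2) this amounts to writing a pair \<open>(x, y)\<close> over \<open>R/\<pi>R\<close> as a multiple of a
  unimodular column that lifts to \<open>SL\<^sub>2(R)\<close>; diagonal matrices over \<open>R/\<pi>R\<close> always lift, being products
  of elementary ones. Given transitivity, a matrix of \<open>SL\<^sub>2(R[1/\<pi>])\<close> is brought into \<open>SL\<^sub>2(R)\<close> by
  moving along the tree two edges at a time, which lowers the power of \<open>\<pi>\<close> in the denominator.
  Conversely, every \<open>(x : y)\<close> is the first step of the path from the base vertex to its image under
  a transvection in \<open>SL\<^sub>2(R[1/\<pi>])\<close>; if (1) holds, the transvection is a reduced word in the two
  vertex stabilisers, and by ping-pong the first letter of this word moves \<open>(1 : 0)\<close> to \<open>(x : y)\<close>.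
\<close>

section \<open>Matrices over type-class rings\<close>

lemma mat2_mult_class [simp]:
  "mat2_mult cring_class_ops (Mat2 a b c d) (Mat2 a' b' c' d') =
     Mat2 (a * a' + b * c') (a * b' + b * d') (c * a' + d * c') (c * b' + d * d')"
  by (simp add: class_simps)

declare mat2_mult.simps [simp del]

lemma carrier_class_UNIV: "carrier cring_class_ops = UNIV"
  by (simp add: cring_class_ops_def)

lemma SL2_class_carrier:
  "Mat2 a b c d \<in> carrier (SL2 cring_class_ops) \<longleftrightarrow> a * d - b * c = 1"
  by (simp add: SL2_def class_simps)

lemma mat2_mult_class_assoc:
  "mat2_mult cring_class_ops (mat2_mult cring_class_ops A B) C =
     mat2_mult cring_class_ops A (mat2_mult cring_class_ops B C)"
  by (cases A; cases B; cases C) (simp add: algebra_simps)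

lemma SL2_class_simps:
  "monoid.mult (SL2 R) = mat2_mult R" "\<one>\<^bsub>SL2 cring_class_ops\<^esub> = Mat2 1 0 0 1"
  by (simp_all add: SL2_def class_simps)

lemma det_mult_eq_1:
  fixes a b c d :: "'a::comm_ring_1"
  assumes "a * d - b * c = 1" "a' * d' - b' * c' = 1"
  shows "(a * a' + b * c') * (c * b' + d * d') - (a * b' + b * d') * (c * a' + d * c') = 1"
proof -
  have "(a * a' + b * c') * (c * b' + d * d') - (a * b' + b * d') * (c * a' + d * c') =
      (a * d - b * c) * (a' * d' - b' * c')"
    by (simp add: algebra_simps)
  then show ?thesis
    using assms by simp
qed

lemma SL2_class_group: "group (SL2 (cring_class_ops :: 'a::comm_ring_1 ring))"
proof (rule groupI)
  fix A B assume "A \<in> carrier (SL2 (cring_class_ops :: 'a ring))"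
    "B \<in> carrier (SL2 (cring_class_ops :: 'a ring))"
  then show "A \<otimes>\<^bsub>SL2 cring_class_ops\<^esub> B \<in> carrier (SL2 cring_class_ops)"
  proof (cases A; cases B)
    fix a b c d a' b' c' d'
    assume AB: "A = Mat2 a b c d" "B = Mat2 a' b' c' d'"
      "A \<in> carrier (SL2 (cring_class_ops :: 'a ring))"
      "B \<in> carrier (SL2 (cring_class_ops :: 'a ring))"
    then show ?thesis
      using det_mult_eq_1[of a d b c a' d' b' c'] by (simp add: SL2_class_simps SL2_class_carrier)
  qed
next
  fix A assume A: "A \<in> carrier (SL2 (cring_class_ops :: 'a ring))"
  obtain a b c d where [simp]: "A = Mat2 a b c d"
    by (cases A)
  show "\<exists>B\<in>carrier (SL2 cring_class_ops). B \<otimes>\<^bsub>SL2 cring_class_ops\<^esub> A = \<one>\<^bsub>SL2 cring_class_ops\<^esub>"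
    using A by (intro bexI[of _ "Mat2 d (-b) (-c) a"])
      (auto simp: SL2_class_simps SL2_class_carrier algebra_simps)
  show "\<one>\<^bsub>SL2 cring_class_ops\<^esub> \<otimes>\<^bsub>SL2 cring_class_ops\<^esub> A = A"
    by (simp add: SL2_class_simps)
qed (auto simp: SL2_class_simps SL2_class_carrier mat2_mult_class_assoc)

lemma SL2_class_inv:
  assumes "a * d - b * c = 1"
  shows "inv\<^bsub>SL2 cring_class_ops\<^esub> (Mat2 a b c d) = Mat2 d (-b) (-c) a"
  using assms
  by (intro group.inv_equality[OF SL2_class_group])
    (auto simp: SL2_class_simps SL2_class_carrier algebra_simps)


section \<open>Matrices with a power of the prime as denominator\<close>

text \<open>One common denominator for all four entries keeps the computations in \<open>R\<close>.
  The exponent \<open>n\<close> need not be minimal, so a matrix has many representations.\<close>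

definition frac_mat :: "'a::idom \<Rightarrow> nat \<Rightarrow> 'a \<Rightarrow> 'a \<Rightarrow> 'a \<Rightarrow> 'a \<Rightarrow> 'a fract mat2" where
  "frac_mat \<pi> n a b c d = map_mat2 (\<lambda>x. to_fract x / to_fract \<pi> ^ n) (Mat2 a b c d)"

abbreviation fmult :: "'a::idom fract mat2 \<Rightarrow> 'a fract mat2 \<Rightarrow> 'a fract mat2" (infixl "\<star>" 70) where
  "fmult \<equiv> mat2_mult frac_ring"

lemma to_fract_power: "to_fract (x ^ n) = to_fract x ^ n"
  by (induction n) auto

lemma frac_mat_mult:
  "frac_mat \<pi> n a b c d \<star> frac_mat \<pi> m a' b' c' d' =
     frac_mat \<pi> (n + m) (a * a' + b * c') (a * b' + b * d') (c * a' + d * c') (c * b' + d * d')"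
  by (simp add: frac_mat_def power_add add_divide_distrib)

lemma frac_mat_eq_iff:
  assumes "\<pi> \<noteq> 0"
  shows "frac_mat \<pi> n a b c d = frac_mat \<pi> m a' b' c' d' \<longleftrightarrow>
    \<pi> ^ m * a = \<pi> ^ n * a' \<and> \<pi> ^ m * b = \<pi> ^ n * b' \<and> \<pi> ^ m * c = \<pi> ^ n * c' \<and> \<pi> ^ m * d = \<pi> ^ n * d'"
proof -
  have "to_fract x / to_fract \<pi> ^ n = to_fract y / to_fract \<pi> ^ m \<longleftrightarrow> \<pi> ^ m * x = \<pi> ^ n * y" for x y
  proof -
    have "to_fract x / to_fract \<pi> ^ n = to_fract y / to_fract \<pi> ^ m \<longleftrightarrow>
        to_fract (\<pi> ^ m * x) = to_fract (\<pi> ^ n * y)"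
      using assms by (simp only: to_fract_mult to_fract_power) (simp add: field_simps)
    then show ?thesis by (simp only: to_fract_eq_iff)
  qed
  then show ?thesis
    by (simp add: frac_mat_def)
qed

lemma SL2_base_eq:
  fixes \<pi> :: "'a::idom"
  shows "SL2_base = {frac_mat \<pi> 0 a b c d | a b c d. a * d - b * c = 1}"
proof -
  have "carrier (SL2 (base_ring :: 'a ring)) = {Mat2 a b c d | a b c d. a * d - b * c = 1}"
  proof (rule Set.set_eqI)
    fix A :: "'a mat2"
    show "A \<in> carrier (SL2 base_ring) \<longleftrightarrow> A \<in> {Mat2 a b c d | a b c d. a * d - b * c = 1}"
      by (cases A) (simp add: SL2_class_carrier)
  qed
  then show ?thesis
    unfolding SL2_base_def frac_mat_def by (fastforce simp: image_iff)
qed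

text \<open>Conjugation turns the rows \<open>(a, b)\<close>, \<open>(c, d)\<close> into
  \<open>(a, b / \<pi>)\<close>, \<open>(\<pi> * c, d)\<close>, which is then put over the common
  denominator \<open>\<pi>\<close>.\<close>

lemma SL2_base_conj_eq:
  assumes "\<pi> \<noteq> 0"
  shows "SL2_base_conj \<pi> =
    {frac_mat \<pi> 1 (\<pi> * a) b (\<pi>\<^sup>2 * c) (\<pi> * d) | a b c d. a * d - b * c = 1}"
proof -
  have "diag2 (1 / to_fract \<pi>) 1 \<star> frac_mat \<pi> 0 a b c d \<star> diag2 (to_fract \<pi>) 1 =
      frac_mat \<pi> 1 (\<pi> * a) b (\<pi>\<^sup>2 * c) (\<pi> * d)" for a b c d
    using assms by (simp add: diag2_def frac_mat_def power2_eq_square)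
  then show ?thesis
    unfolding SL2_base_conj_def SL2_base_eq[of \<pi>] by (auto simp: image_iff) metis+
qed

lemma carrier_adjoin_inverse:
  assumes "\<pi> \<noteq> 0"
  shows "carrier (adjoin_inverse \<pi>) = {to_fract r / to_fract \<pi> ^ n | r n. True}"
proof -
  have "x \<in> {to_fract r / to_fract \<pi> ^ n | r n. True}"
    if "x \<in> generate_ring frac_ring (range to_fract \<union> {1 / to_fract \<pi>})" for x
    using that
  proof induction
    case one
    have "(1 :: 'a fract) = to_fract 1 / to_fract \<pi> ^ 0"
      by simp
    then show ?case
      unfolding one_class by blast
  next
    case (incl h)
    then show ?case
    proof
      assume "h \<in> range to_fract"
      then obtain r where "h = to_fract r / to_fract \<pi> ^ 0"
        by auto
      then show ?thesis
        by blast
    next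
      assume "h \<in> {1 / to_fract \<pi>}"
      then have "h = to_fract 1 / to_fract \<pi> ^ 1"
        by simp
      then show ?thesis
        by blast
    qed
  next
    case (a_inv h)
    then obtain r n where "h = to_fract r / to_fract \<pi> ^ n" by auto
    then have "- h = to_fract (- r) / to_fract \<pi> ^ n"
      by simp
    then show ?case
      unfolding uminus_class by blast
  next
    case (eng_add h1 h2)
    then obtain r n s m where "h1 = to_fract r / to_fract \<pi> ^ n" "h2 = to_fract s / to_fract \<pi> ^ m"
      by auto
    then have "h1 + h2 = to_fract (r * \<pi> ^ m + s * \<pi> ^ n) / to_fract \<pi> ^ (n + m)"
      using assms by (simp add: to_fract_power add_divide_distrib power_add)
    then show ?case
      unfolding plus_class by blast
  next
    case (eng_mult h1 h2)
    then obtain r n s m where "h1 = to_fract r / to_fract \<pi> ^ n" "h2 = to_fract s / to_fract \<pi> ^ m"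
      by auto
    then have "h1 * h2 = to_fract (r * s) / to_fract \<pi> ^ (n + m)"
      by (simp add: power_add)
    then show ?case
      unfolding times_class by blast
  qed
  moreover have "to_fract r / to_fract \<pi> ^ n \<in>
      generate_ring frac_ring (range to_fract \<union> {1 / to_fract \<pi>})" for r n
  proof (induction n)
    case 0
    show ?case
      by (auto intro: generate_ring.incl)
  next
    case (Suc n)
    have "1 / to_fract \<pi> \<in> generate_ring frac_ring (range to_fract \<union> {1 / to_fract \<pi>})"
      by (rule generate_ring.incl) simp
    from generate_ring.eng_mult[OF this Suc] show ?case
      by (simp add: class_simps)
  qed
  ultimately show ?thesis
    unfolding adjoin_inverse_def by auto
qed

lemma carrier_SL2_adjoin_inverse:
  assumes "\<pi> \<noteq> 0"
  shows "carrier (SL2 (adjoin_inverse \<pi>)) =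
    {frac_mat \<pi> n a b c d | n a b c d. a * d - b * c = \<pi> ^ (2 * n)}"
proof -
  let ?S = "adjoin_inverse \<pi>"
  have ring: "ring ?S"
    unfolding adjoin_inverse_def
    by (rule ring.generate_ring_is_ring[OF cring.axioms(1)[OF cring_class]]) (simp add: carrier_class subsetI)
  have ops: "\<one>\<^bsub>?S\<^esub> = 1" "\<zero>\<^bsub>?S\<^esub> = 0" "x \<oplus>\<^bsub>?S\<^esub> y = x + y" "x \<otimes>\<^bsub>?S\<^esub> y = x * y" for x y
    by (simp_all add: adjoin_inverse_def class_simps)
  \<comment> \<open>\<open>\<ominus>\<close> of the record is the inverse inside the carrier; it
    agrees with negation in \<open>F\<close> once the carrier is known to contain
    \<open>- y\<close>.\<close>
  have uminus: "- y \<in> carrier ?S \<and> \<ominus>\<^bsub>?S\<^esub> y = - y" if y: "y \<in> carrier ?S" for y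
  proof
    obtain r n where "y = to_fract r / to_fract \<pi> ^ n"
      using y by (auto simp: carrier_adjoin_inverse[OF assms])
    then have "- y = to_fract (- r) / to_fract \<pi> ^ n"
      by simp
    then show "- y \<in> carrier ?S"
      unfolding carrier_adjoin_inverse[OF assms] by blast
    then show "\<ominus>\<^bsub>?S\<^esub> y = - y"
      using y by (intro abelian_group.minus_equality[OF ring.is_abelian_group[OF ring]]) (simp_all add: ops)
  qed
  have det: "mat2_det ?S (Mat2 a b c d) = a * d - b * c" if "b \<in> carrier ?S" "c \<in> carrier ?S" for a b c d
  proof -
    have "b * c \<in> carrier ?S"
      using ring.ring_simprules(5)[OF ring that] by (simp add: ops)
    then show ?thesis
      using uminus[of "b * c"] by (simp add: a_minus_def ops)
  qed
  have \<pi>: "to_fract \<pi> \<noteq> 0"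
    using assms by simp
  have carr: "Mat2 a b c d \<in> carrier (SL2 ?S) \<longleftrightarrow>
      {a, b, c, d} \<subseteq> carrier ?S \<and> a * d - b * c = 1" for a b c d
    using det[of b c a d] unfolding SL2_def by (auto simp: ops simp del: mat2_det.simps)
  have det_frac: "to_fract a / to_fract \<pi> ^ n * (to_fract d / to_fract \<pi> ^ n) -
      to_fract b / to_fract \<pi> ^ n * (to_fract c / to_fract \<pi> ^ n) = 1
      \<longleftrightarrow> a * d - b * c = \<pi> ^ (2 * n)" for a b c d n
  proof -
    have "to_fract a / to_fract \<pi> ^ n * (to_fract d / to_fract \<pi> ^ n) -
      to_fract b / to_fract \<pi> ^ n * (to_fract c / to_fract \<pi> ^ n) =
      to_fract (a * d - b * c) / to_fract (\<pi> ^ (2 * n))"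
      by (simp only: to_fract_diff to_fract_mult to_fract_power)
        (simp add: mult_2 power_add diff_divide_distrib)
    also have "\<dots> = 1 \<longleftrightarrow> to_fract (a * d - b * c) = to_fract (\<pi> ^ (2 * n))"
      using assms by (simp add: divide_eq_1_iff del: to_fract_diff)
    finally show ?thesis
      by (simp only: to_fract_eq_iff)
  qed
  show ?thesis
  proof (intro equalityI subsetI)
    fix A assume A: "A \<in> carrier (SL2 ?S)"
    then obtain x y z w where [simp]: "A = Mat2 x y z w"
      by (cases A)
    have xyzw: "{x, y, z, w} \<subseteq> carrier ?S" "x * w - y * z = 1"
      using A carr by auto
    then obtain a b c d k l m n where eqs: "x = to_fract a / to_fract \<pi> ^ k"
      "y = to_fract b / to_fract \<pi> ^ l" "z = to_fract c / to_fract \<pi> ^ m" "w = to_fract d / to_fract \<pi> ^ n"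
      by (auto simp: carrier_adjoin_inverse[OF assms])
    have common: "to_fract r / to_fract \<pi> ^ i = to_fract (r * \<pi> ^ j) / to_fract \<pi> ^ (i + j)" for r i j
      using assms by (simp add: to_fract_power power_add)
    let ?N = "k + l + m + n"
    let ?a = "a * \<pi> ^ (l + m + n)" and ?b = "b * \<pi> ^ (k + m + n)"
      and ?c = "c * \<pi> ^ (k + l + n)" and ?d = "d * \<pi> ^ (k + l + m)"
    have "x = to_fract ?a / to_fract \<pi> ^ ?N" "y = to_fract ?b / to_fract \<pi> ^ ?N"
      "z = to_fract ?c / to_fract \<pi> ^ ?N" "w = to_fract ?d / to_fract \<pi> ^ ?N"
      unfolding eqs
      using common[of a k "l + m + n"] common[of b l "k + m + n"] common[of c m "k + l + n"]
        common[of d n "k + l + m"] by (simp_all add: ac_simps)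
    then obtain a' b' c' d' N where eqs': "x = to_fract a' / to_fract \<pi> ^ N"
      "y = to_fract b' / to_fract \<pi> ^ N" "z = to_fract c' / to_fract \<pi> ^ N" "w = to_fract d' / to_fract \<pi> ^ N"
      by blast
    then have "a' * d' - b' * c' = \<pi> ^ (2 * N)"
      using xyzw(2) det_frac by simp
    moreover have "A = frac_mat \<pi> N a' b' c' d'"
      by (simp add: frac_mat_def eqs')
    ultimately show "A \<in> {frac_mat \<pi> n a b c d | n a b c d. a * d - b * c = \<pi> ^ (2 * n)}"
      by blast
  next
    fix A assume "A \<in> {frac_mat \<pi> n a b c d | n a b c d. a * d - b * c = \<pi> ^ (2 * n)}"
    then obtain n a b c d where A: "A = frac_mat \<pi> n a b c d" "a * d - b * c = \<pi> ^ (2 * n)"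
      by auto
    show "A \<in> carrier (SL2 ?S)"
      unfolding A frac_mat_def mat2.map carr det_frac
      using A(2) by (auto simp: carrier_adjoin_inverse[OF assms])
  qed
qed

section \<open>The residue ring\<close>

text \<open>Two generators suffice, by induction on the finite set: \<open>Idl S\<close> has a
  single generator \<open>b\<close>, and \<open>{a, b}\<close> is then replaced by the common
  divisor \<open>t\<close>.\<close>

lemma (in cring) bezout_ringI:
  assumes "\<And>a b. \<lbrakk>a \<in> carrier R; b \<in> carrier R\<rbrakk> \<Longrightarrow> \<exists>t\<in>Idl {a, b}. a \<in> PIdl t \<and> b \<in> PIdl t"
  shows "bezout_ring R"
  unfolding bezout_ring_def
proof (intro conjI allI impI)
  show "cring R" by (rule is_cring)
  fix S assume S: "finite S \<and> S \<subseteq> carrier R"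
  have "\<exists>t\<in>carrier R. Idl S = PIdl t"
    using S[THEN conjunct1] S[THEN conjunct2]
  proof (induction S)
    case empty
    have "Idl {} \<subseteq> {\<zero>}"
      by (rule genideal_minimal[OF zeroideal]) simp
    moreover have "\<zero> \<in> Idl {}"
      by (rule additive_subgroup.zero_closed[OF ideal.axioms(1)[OF genideal_ideal]]) simp
    ultimately have "Idl {} = PIdl \<zero>"
      unfolding cgenideal_eq_genideal[OF zero_closed] genideal_zero by blast
    then show ?case by blast
  next
    case (insert a S)
    then obtain b where b: "b \<in> carrier R" "Idl S = PIdl b" by auto
    have a: "a \<in> carrier R" using insert by simp
    have S: "S \<subseteq> carrier R" using insert by simp
    obtain t where t: "t \<in> Idl {a, b}" "a \<in> PIdl t" "b \<in> PIdl t"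
      using assms a b by blast
    have ab: "ideal (Idl {a, b}) R" by (rule genideal_ideal) (use a b in auto)
    have t_carr: "t \<in> carrier R" by (rule ideal.Icarr[OF ab t(1)])
    have t_ideal: "ideal (PIdl t) R" by (rule cgenideal_ideal[OF t_carr])
    have aS: "ideal (Idl (insert a S)) R" by (rule genideal_ideal) (use a S in auto)
    have "Idl S \<subseteq> PIdl t"
      using cgenideal_minimal[OF t_ideal t(3)] b by simp
    then have "insert a S \<subseteq> PIdl t"
      using t(2) genideal_self[OF S] by auto
    then have 1: "Idl (insert a S) \<subseteq> PIdl t"
      by (rule genideal_minimal[OF t_ideal])
    have "b \<in> Idl (insert a S)"
      using cgenideal_self[OF b(1)] b(2) subset_Idl_subset[of "insert a S" S] a S by auto
    moreover have "a \<in> Idl (insert a S)"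
      using genideal_self[of "insert a S"] a S by auto
    ultimately have "Idl {a, b} \<subseteq> Idl (insert a S)"
      by (intro genideal_minimal[OF aS]) auto
    then have "PIdl t \<subseteq> Idl (insert a S)"
      using t(1) by (intro cgenideal_minimal[OF aS]) auto
    with 1 t_carr show ?case by blast
  qed
  then show "principalideal (Idl S) R"
    using cgenideal_is_principalideal by auto
qed

text \<open>A generator \<open>t\<close> of \<open>Idl {a, b}\<close> divides both elements and lies
  in the sum of their principal ideals, which gives the Bezout identity.\<close>

lemma bezout_ringE:
  fixes R (structure)
  assumes "bezout_ring R" "a \<in> carrier R" "b \<in> carrier R"
  obtains t u v x y where "t \<in> carrier R" "u \<in> carrier R" "v \<in> carrier R"
    "x \<in> carrier R" "y \<in> carrier R" "a = x \<otimes> t" "b = y \<otimes> t" "t = u \<otimes> a \<oplus> v \<otimes> b"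
proof -
  interpret cring R using assms(1) by (simp add: bezout_ring_def)
  have "principalideal (Idl S) R" if "finite S \<and> S \<subseteq> carrier R" for S
    using assms(1) that unfolding bezout_ring_def by simp
  from this[of "{a, b}"] have "principalideal (Idl {a, b}) R"
    using assms(2,3) by simp
  from principalideal.generate[OF this]
  obtain t where t: "t \<in> carrier R" "Idl {a, b} = PIdl t"
    by (auto simp: cgenideal_eq_genideal)
  have ab: "{a, b} \<subseteq> PIdl t"
    using genideal_self[of "{a, b}"] assms t by auto
  have ids: "ideal (PIdl a) R" "ideal (PIdl b) R"
    using assms by (auto intro: cgenideal_ideal)
  have "PIdl a \<union> PIdl b \<subseteq> PIdl a <+> PIdl b"
    unfolding union_genideal[OF ids, symmetric]
    by (rule genideal_self) (auto dest: ideal.Icarr[OF ids(1)] ideal.Icarr[OF ids(2)])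
  then have "{a, b} \<subseteq> PIdl a <+> PIdl b"
    using cgenideal_self[OF assms(2)] cgenideal_self[OF assms(3)] by auto
  then have "Idl {a, b} \<subseteq> PIdl a <+> PIdl b"
    by (rule genideal_minimal[OF add_ideals[OF ids]])
  then have "t \<in> PIdl a <+> PIdl b"
    using t(2) cgenideal_self[OF t(1)] by auto
  then obtain u v where "u \<in> carrier R" "v \<in> carrier R" "t = u \<otimes> a \<oplus> v \<otimes> b"
    by (auto simp: set_add_def' cgenideal_def)
  moreover obtain x y where "x \<in> carrier R" "y \<in> carrier R" "a = x \<otimes> t" "b = y \<otimes> t"
    using ab by (auto simp: cgenideal_def)
  ultimately show thesis
    using t(1) by (intro that)
qed

section \<open>Arithmetic in \<open>R/\<pi>R\<close> as congruences modulo \<pi>\<close>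

lemma PIdl_class: "PIdl\<^bsub>cring_class_ops\<^esub> p = {x. p dvd x}"
  by (auto simp: cgenideal_def class_simps carrier_class dvd_def mult.commute)

lemma residue_ideal: "ideal (PIdl\<^bsub>base_ring\<^esub> \<pi>) base_ring"
  by (rule cring.cgenideal_ideal[OF cring_class carrier_class])

lemma residue_hom: "ring_hom_cring base_ring (residue_ring_at \<pi>) (residue_class \<pi>)"
proof -
  have "residue_class \<pi> = (+>\<^bsub>base_ring\<^esub>) (PIdl\<^bsub>base_ring\<^esub> \<pi>)"
    by (simp add: residue_class_def fun_eq_iff)
  then show ?thesis
    using ideal.rcos_ring_hom_cring[OF residue_ideal cring_class] by (simp add: residue_ring_at_def)
qed

lemma residue_class_eq_iff: "residue_class \<pi> x = residue_class \<pi> y \<longleftrightarrow> \<pi> dvd x - y"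
  using ring.quotient_eq_iff_same_a_r_cos[OF cring.axioms(1)[OF cring_class] residue_ideal carrier_class carrier_class,
      of x y \<pi>]
  by (simp add: residue_class_def PIdl_class minus_class)

lemma carrier_residue_ring: "carrier (residue_ring_at \<pi>) = range (residue_class \<pi>)"
  by (auto simp: residue_ring_at_def residue_class_def FactRing_def A_RCOSETS_def' class_simps
      carrier_class_UNIV)

lemma residue_class_carrier: "residue_class \<pi> x \<in> carrier (residue_ring_at \<pi>)"
  by (simp add: carrier_residue_ring)

lemma residue_class_simps:
  "\<zero>\<^bsub>residue_ring_at \<pi>\<^esub> = residue_class \<pi> 0" "\<one>\<^bsub>residue_ring_at \<pi>\<^esub> = residue_class \<pi> 1"
  "residue_class \<pi> x \<oplus>\<^bsub>residue_ring_at \<pi>\<^esub> residue_class \<pi> y = residue_class \<pi> (x + y)"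
  "residue_class \<pi> x \<otimes>\<^bsub>residue_ring_at \<pi>\<^esub> residue_class \<pi> y = residue_class \<pi> (x * y)"
  "residue_class \<pi> x \<ominus>\<^bsub>residue_ring_at \<pi>\<^esub> residue_class \<pi> y = residue_class \<pi> (x - y)"
proof -
  interpret h: ring_hom_cring base_ring "residue_ring_at \<pi>" "residue_class \<pi>"
    by (rule residue_hom)
  show "\<zero>\<^bsub>residue_ring_at \<pi>\<^esub> = residue_class \<pi> 0" "\<one>\<^bsub>residue_ring_at \<pi>\<^esub> = residue_class \<pi> 1"
    using h.hom_zero h.hom_one by (simp_all add: class_simps)
  show "residue_class \<pi> x \<oplus>\<^bsub>residue_ring_at \<pi>\<^esub> residue_class \<pi> y = residue_class \<pi> (x + y)"
    "residue_class \<pi> x \<otimes>\<^bsub>residue_ring_at \<pi>\<^esub> residue_class \<pi> y = residue_class \<pi> (x * y)"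
    using h.hom_add[of x y] h.hom_mult[of x y] by (simp_all add: class_simps)
  have "residue_class \<pi> (x + - y) = residue_class \<pi> x \<oplus>\<^bsub>residue_ring_at \<pi>\<^esub> residue_class \<pi> (- y)"
    using h.hom_add[of x "- y"] by (simp add: class_simps)
  then show "residue_class \<pi> x \<ominus>\<^bsub>residue_ring_at \<pi>\<^esub> residue_class \<pi> y = residue_class \<pi> (x - y)"
    using h.hom_a_inv[of y] by (simp add: a_minus_def class_simps)
qed

lemma residue_domain:
  assumes "prime_elem \<pi>"
  shows "domain (residue_ring_at \<pi>)"
proof -
  have "primeideal (PIdl\<^bsub>base_ring\<^esub> \<pi>) base_ring"
  proof (rule primeidealI[OF residue_ideal cring_class])
    show "carrier base_ring \<noteq> PIdl\<^bsub>base_ring\<^esub> \<pi>"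
      using assms carrier_class[of "1 :: 'a"] unfolding PIdl_class prime_elem_def by auto
  qed (use assms in \<open>auto simp: PIdl_class times_class dest: prime_elem_dvd_multD\<close>)
  then show ?thesis
    unfolding residue_ring_at_def by (rule primeideal.quotient_is_domain)
qed

lemma SL2_residue_carrier:
  "Mat2 (residue_class \<pi> a) (residue_class \<pi> b) (residue_class \<pi> c) (residue_class \<pi> d) \<in>
     carrier (SL2 (residue_ring_at \<pi>)) \<longleftrightarrow> \<pi> dvd a * d - b * c - 1"
  by (simp add: SL2_def residue_class_simps carrier_residue_ring residue_class_eq_iff rangeI)

text \<open>Every point \<open>(x : y)\<close> of the projective line over the field of fractions of \<open>R/\<pi>R\<close> is moved
  to \<open>(1 : 0)\<close> by an element of \<open>SL\<^sub>2(R)\<close>.\<close>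

definition transitive_mod :: "'a::idom \<Rightarrow> bool" where
  "transitive_mod \<pi> \<longleftrightarrow> (\<forall>x y. \<exists>a b c d. a * d - b * c = 1 \<and> \<pi> dvd c * x + d * y)"

section \<open>Equivalence of statement (2) with transitivity\<close>

lemma transitive_mod_if_bezout_lift:
  assumes "prime_elem \<pi>" "bezout_ring (residue_ring_at \<pi>)"
    and lift: "carrier (SL2 (residue_ring_at \<pi>)) \<subseteq> map_mat2 (residue_class \<pi>) ` carrier (SL2 base_ring)"
  shows "transitive_mod \<pi>"
  unfolding transitive_mod_def
proof (intro allI)
  fix x y :: 'a
  show "\<exists>a b c d. a * d - b * c = 1 \<and> \<pi> dvd c * x + d * y"
  proof (cases "\<pi> dvd x \<and> \<pi> dvd y")
    case True
    then show ?thesis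
      by (intro exI[of _ 1] exI[of _ 0]) simp
  next
    case False
    obtain T U V \<xi> \<eta> where carr: "T \<in> carrier (residue_ring_at \<pi>)" "U \<in> carrier (residue_ring_at \<pi>)"
      "V \<in> carrier (residue_ring_at \<pi>)" "\<xi> \<in> carrier (residue_ring_at \<pi>)" "\<eta> \<in> carrier (residue_ring_at \<pi>)"
      and TUV: "residue_class \<pi> x = \<xi> \<otimes>\<^bsub>residue_ring_at \<pi>\<^esub> T" "residue_class \<pi> y = \<eta> \<otimes>\<^bsub>residue_ring_at \<pi>\<^esub> T"
      "T = U \<otimes>\<^bsub>residue_ring_at \<pi>\<^esub> residue_class \<pi> x \<oplus>\<^bsub>residue_ring_at \<pi>\<^esub> V \<otimes>\<^bsub>residue_ring_at \<pi>\<^esub> residue_class \<pi> y"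
      by (rule bezout_ringE[OF assms(2) residue_class_carrier residue_class_carrier])
    from carr obtain t u v p q where eqs: "T = residue_class \<pi> t" "U = residue_class \<pi> u" "V = residue_class \<pi> v"
      "\<xi> = residue_class \<pi> p" "\<eta> = residue_class \<pi> q"
      unfolding carrier_residue_ring by blast
    have x: "\<pi> dvd x - p * t" and y: "\<pi> dvd y - q * t" and t: "\<pi> dvd t - (u * x + v * y)"
      using TUV unfolding eqs residue_class_simps residue_class_eq_iff by (simp_all only:)
    have "\<not> \<pi> dvd t"
    proof
      assume "\<pi> dvd t"
      then have "\<pi> dvd (x - p * t) + p * t" "\<pi> dvd (y - q * t) + q * t"
        using x y by (simp_all only: dvd_add dvd_mult)
      with False show False by simp
    qed
    \<comment> \<open>Substitute \<open>p * t\<close> for \<open>x\<close> and \<open>q * t\<close>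
      for \<open>y\<close> in the Bezout identity of \<open>t\<close>; the factor \<open>t\<close>
      is then cancelled modulo the prime.\<close>
    moreover have "\<pi> dvd t * (u * p + v * q - 1)"
    proof -
      have "t * (u * p + v * q - 1) = - u * (x - p * t) - v * (y - q * t) - (t - (u * x + v * y))"
        by (simp add: algebra_simps)
      also have "\<pi> dvd \<dots>"
        by (intro dvd_diff dvd_mult x y t)
      finally show ?thesis .
    qed
    ultimately have "\<pi> dvd u * p - v * (- q) - 1"
      using prime_elem_dvd_mult_iff[OF assms(1)] by simp
    \<comment> \<open>The lower row \<open>(- q, p)\<close> annihilates \<open>(p, q)\<close>, hence
      also \<open>(x, y)\<close>, which is \<open>t\<close> times \<open>(p, q)\<close> modulo
      \<pi>. A lift to \<open>SL\<^sub>2(R)\<close> is the matrix sought.\<close>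
    then have "Mat2 (residue_class \<pi> u) (residue_class \<pi> v) (residue_class \<pi> (- q)) (residue_class \<pi> p) \<in>
        map_mat2 (residue_class \<pi>) ` carrier (SL2 base_ring)"
      using lift SL2_residue_carrier by blast
    then obtain A where A: "A \<in> carrier (SL2 base_ring)"
      "Mat2 (residue_class \<pi> u) (residue_class \<pi> v) (residue_class \<pi> (- q)) (residue_class \<pi> p) =
        map_mat2 (residue_class \<pi>) A"
      by auto
    obtain a b c d where "A = Mat2 a b c d" by (cases A)
    with A have det: "a * d - b * c = 1" and c: "\<pi> dvd - q - c" and d: "\<pi> dvd p - d"
      by (simp_all add: SL2_class_carrier residue_class_eq_iff)
    have "c * x + d * y = - x * (- q - c) - y * (p - d) - q * (x - p * t) + p * (y - q * t)"
      by (simp add: algebra_simps)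
    also have "\<pi> dvd \<dots>"
      by (intro dvd_add dvd_diff dvd_mult c d x y)
    finally show ?thesis
      using det by blast
  qed
qed

text \<open>Moving \<open>(x, y)\<close> to \<open>(t, 0)\<close> by a matrix of determinant 1
  preserves the ideal of the coordinates, so \<open>t\<close> generates it. For lifting, the same
  move makes a matrix over \<open>R/\<pi>R\<close> upper triangular with units on the
  diagonal.\<close>

lemma bezout_lift_if_transitive_mod:
  assumes "prime_elem \<pi>" and trans: "transitive_mod \<pi>"
  shows "bezout_ring (residue_ring_at \<pi>)"
    and "map_mat2 (residue_class \<pi>) ` carrier (SL2 base_ring) = carrier (SL2 (residue_ring_at \<pi>))"
proof -
  interpret B: domain "residue_ring_at \<pi>"
    by (rule residue_domain[OF assms(1)])
  show "bezout_ring (residue_ring_at \<pi>)"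
  proof (rule B.bezout_ringI)
    fix \<xi> \<eta> assume XY: "\<xi> \<in> carrier (residue_ring_at \<pi>)" "\<eta> \<in> carrier (residue_ring_at \<pi>)"
    then obtain x y where [simp]: "\<xi> = residue_class \<pi> x" "\<eta> = residue_class \<pi> y"
      by (auto simp: carrier_residue_ring)
    obtain a b c d where det: "a * d - b * c = 1" and dvd: "\<pi> dvd c * x + d * y"
      using trans unfolding transitive_mod_def by blast
    let ?t = "a * x + b * y"
    \<comment> \<open>The inverse matrix, with first column \<open>(d, - c)\<close>, recovers
      \<open>(x, y)\<close> from its image \<open>(?t, 0)\<close> modulo \<pi>.\<close>
    have "x - d * ?t = (1 - (a * d - b * c)) * x - b * (c * x + d * y)"
      "y - (- c) * ?t = (1 - (a * d - b * c)) * y + a * (c * x + d * y)"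
      by (simp_all add: algebra_simps)
    then have "\<pi> dvd x - d * ?t" "\<pi> dvd y - (- c) * ?t"
      unfolding det by (simp_all only: dvd dvd_mult dvd_diff dvd_add diff_self mult_zero_left dvd_0_right)
    then have "\<xi> = residue_class \<pi> d \<otimes>\<^bsub>residue_ring_at \<pi>\<^esub> residue_class \<pi> ?t"
      "\<eta> = residue_class \<pi> (- c) \<otimes>\<^bsub>residue_ring_at \<pi>\<^esub> residue_class \<pi> ?t"
      by (simp_all only: residue_class_simps residue_class_eq_iff \<open>\<xi> = residue_class \<pi> x\<close>
          \<open>\<eta> = residue_class \<pi> y\<close>)
    then have "\<xi> \<in> PIdl\<^bsub>residue_ring_at \<pi>\<^esub> (residue_class \<pi> ?t)" "\<eta> \<in> PIdl\<^bsub>residue_ring_at \<pi>\<^esub> (residue_class \<pi> ?t)"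
      unfolding cgenideal_def by (auto simp: carrier_residue_ring)
    moreover have "residue_class \<pi> ?t \<in> Idl\<^bsub>residue_ring_at \<pi>\<^esub> {\<xi>, \<eta>}"
    proof -
      have I: "ideal (Idl\<^bsub>residue_ring_at \<pi>\<^esub> {\<xi>, \<eta>}) (residue_ring_at \<pi>)"
        using XY by (intro B.genideal_ideal) simp
      have "{\<xi>, \<eta>} \<subseteq> Idl\<^bsub>residue_ring_at \<pi>\<^esub> {\<xi>, \<eta>}"
        using XY by (intro B.genideal_self) simp
      then have "residue_class \<pi> a \<otimes>\<^bsub>residue_ring_at \<pi>\<^esub> \<xi> \<oplus>\<^bsub>residue_ring_at \<pi>\<^esub>
          residue_class \<pi> b \<otimes>\<^bsub>residue_ring_at \<pi>\<^esub> \<eta> \<in> Idl\<^bsub>residue_ring_at \<pi>\<^esub> {\<xi>, \<eta>}"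
        by (intro additive_subgroup.a_closed[OF ideal.axioms(1)[OF I]] ideal.I_l_closed[OF I])
          (auto simp: carrier_residue_ring)
      then show ?thesis
        by (simp add: residue_class_simps)
    qed
    ultimately show "\<exists>T\<in>Idl\<^bsub>residue_ring_at \<pi>\<^esub> {\<xi>, \<eta>}.
        \<xi> \<in> PIdl\<^bsub>residue_ring_at \<pi>\<^esub> T \<and> \<eta> \<in> PIdl\<^bsub>residue_ring_at \<pi>\<^esub> T"
      by blast
  qed
  show "map_mat2 (residue_class \<pi>) ` carrier (SL2 base_ring) = carrier (SL2 (residue_ring_at \<pi>))"
  proof (intro equalityI subsetI)
    fix M assume "M \<in> map_mat2 (residue_class \<pi>) ` carrier (SL2 base_ring)"
    then obtain A where A: "A \<in> carrier (SL2 base_ring)" "M = map_mat2 (residue_class \<pi>) A"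
      by auto
    then show "M \<in> carrier (SL2 (residue_ring_at \<pi>))"
      by (cases A) (simp add: SL2_class_carrier SL2_residue_carrier)
  next
    fix M assume M: "M \<in> carrier (SL2 (residue_ring_at \<pi>))"
    obtain \<xi> Z \<eta> W where "M = Mat2 \<xi> Z \<eta> W" by (cases M)
    moreover from this M have "{\<xi>, \<eta>, Z, W} \<subseteq> range (residue_class \<pi>)"
      by (simp add: SL2_def carrier_residue_ring)
    ultimately obtain x z y w
      where M_eq: "M = Mat2 (residue_class \<pi> x) (residue_class \<pi> z) (residue_class \<pi> y) (residue_class \<pi> w)"
      by auto
    then have detM: "\<pi> dvd x * w - z * y - 1"
      using M SL2_residue_carrier by blast
    obtain a b c d where det: "a * d - b * c = 1" and dvd: "\<pi> dvd c * x + d * y"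
      using trans unfolding transitive_mod_def by blast
    \<comment> \<open>Modulo \<pi>, the matrix with rows \<open>(a, b)\<close>,
      \<open>(c, d)\<close> times \<open>M\<close> has rows \<open>(t, u)\<close> and
      \<open>(0, s)\<close>.\<close>
    define t where "t = a * x + b * y"
    define u where "u = a * z + b * w"
    define s where "s = c * z + d * w"
    have "t * s - u * (c * x + d * y) = (a * d - b * c) * (x * w - z * y)"
      unfolding t_def s_def u_def by (simp add: algebra_simps)
    then have ts: "t * s - 1 = (x * w - z * y - 1) + u * (c * x + d * y)"
      using det by (simp add: algebra_simps)
    have ts: "\<pi> dvd t * s - 1"
      unfolding ts using detM dvd by (simp only: dvd_add dvd_mult)
    \<comment> \<open>By Whitehead's lemma, \<open>diag(t, s)\<close> lifts from \<open>R/\<pi>R\<close> to the product of elementary matrices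
      with rows \<open>(t (2 - t s), t s - 1)\<close> and \<open>(1 - t s, s)\<close>. Multiplied by the elementary matrix with
      rows \<open>(1, s u)\<close> and \<open>(0, 1)\<close>, it becomes the lift of \<open>(t, u)\<close>, \<open>(0, s)\<close> with rows \<open>(p, q)\<close>, \<open>(- e, r)\<close>.\<close>
    define e where "e = t * s - 1"
    define p q r where "p = t * (1 - e)" and "q = p * s * u + e" and "r = s - e * s * u"
    have ps: "p * s = 1 - e * e"
      unfolding p_def e_def by (simp add: algebra_simps)
    have "p * r + q * e = p * s + e * e"
      unfolding q_def r_def by (simp add: algebra_simps)
    also have "\<dots> = 1"
      unfolding ps by simp
    finally have "p * r + q * e = 1" .
    then have 1: "p * r - q * (- e) = 1" by simp
    have pt: "\<pi> dvd p - t" and e: "\<pi> dvd e" and r: "\<pi> dvd r - s"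
      using ts unfolding p_def r_def e_def[symmetric] by (simp_all add: algebra_simps)
    have "q - u = e * (1 - e * u)"
      unfolding q_def ps by (simp add: algebra_simps)
    then have q: "\<pi> dvd q - u"
      using e by simp
    define k where "k = c * x + d * y"
    have k: "\<pi> dvd k"
      using dvd by (simp add: k_def)
    have det': "a * d = 1 + b * c"
      using det by (simp add: algebra_simps)
    \<comment> \<open>The lift of \<open>M\<close> is the inverse matrix, with rows
      \<open>(d, - b)\<close>, \<open>(- c, a)\<close>, times the one with rows
      \<open>(p, q)\<close>, \<open>(- e, r)\<close>. Its four entries are compared with
      \<open>M\<close> one by one.\<close>
    have "\<pi> dvd x - (d * p + b * e)"
    proof -
      have "x - (d * p + b * e) = - d * (p - t) - b * e - b * k + (1 + b * c - a * d) * x"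
        unfolding t_def k_def by (simp add: algebra_simps)
      also have "\<dots> = - d * (p - t) - b * e - b * k"
        by (simp add: det')
      also have "\<pi> dvd \<dots>"
        by (intro dvd_add dvd_diff dvd_mult pt e k)
      finally show ?thesis .
    qed
    moreover have "\<pi> dvd z - (d * q - b * r)"
    proof -
      have "z - (d * q - b * r) = b * (r - s) - d * (q - u) + (1 + b * c - a * d) * z"
        unfolding s_def u_def by (simp add: algebra_simps)
      also have "\<dots> = b * (r - s) - d * (q - u)"
        by (simp add: det')
      also have "\<pi> dvd \<dots>"
        by (intro dvd_add dvd_diff dvd_mult q r)
      finally show ?thesis .
    qed
    moreover have "\<pi> dvd y - (- c * p - a * e)"
    proof -
      have "y - (- c * p - a * e) = c * (p - t) + a * e + a * k + (1 + b * c - a * d) * y"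
        unfolding t_def k_def by (simp add: algebra_simps)
      also have "\<dots> = c * (p - t) + a * e + a * k"
        by (simp add: det')
      also have "\<pi> dvd \<dots>"
        by (intro dvd_add dvd_diff dvd_mult pt e k)
      finally show ?thesis .
    qed
    moreover have "\<pi> dvd w - (- c * q + a * r)"
    proof -
      have "w - (- c * q + a * r) = c * (q - u) - a * (r - s) + (1 + b * c - a * d) * w"
        unfolding s_def u_def by (simp add: algebra_simps)
      also have "\<dots> = c * (q - u) - a * (r - s)"
        by (simp add: det')
      also have "\<pi> dvd \<dots>"
        by (intro dvd_add dvd_diff dvd_mult q r)
      finally show ?thesis .
    qed
    ultimately have "M = map_mat2 (residue_class \<pi>)
        (Mat2 (d * p + b * e) (d * q - b * r) (- c * p - a * e) (- c * q + a * r))"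
      unfolding M_eq mat2.map by (simp only: mat2.inject residue_class_eq_iff simp_thms)
    moreover have "(d * p + b * e) * (- c * q + a * r) - (d * q - b * r) * (- c * p - a * e) =
        (a * d - b * c) * (p * r - q * (- e))"
      by (simp add: algebra_simps)
    then have "Mat2 (d * p + b * e) (d * q - b * r) (- c * p - a * e) (- c * q + a * r) \<in> carrier (SL2 base_ring)"
      unfolding SL2_class_carrier using det 1 by simp
    ultimately show "M \<in> map_mat2 (residue_class \<pi>) ` carrier (SL2 base_ring)"
      by blast
  qed
qed

section \<open>From transitivity to generation\<close>

lemma frac_mat_inv:
  assumes "\<pi> \<noteq> 0" "a * d - b * c = \<pi> ^ (2 * n)"
  shows "inv\<^bsub>SL2 frac_ring\<^esub> (frac_mat \<pi> n a b c d) = frac_mat \<pi> n d (- b) (- c) a"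
proof -
  have "to_fract (a * d - b * c) = to_fract \<pi> ^ n * to_fract \<pi> ^ n"
    unfolding assms(2) by (simp add: to_fract_power mult_2 power_add)
  then show ?thesis
    unfolding frac_mat_def mat2.map using assms(1)
    by (subst SL2_class_inv) (simp_all add: diff_divide_distrib[symmetric])
qed

text \<open>The easy inclusion in (1): determinants are multiplicative and inverses are adjugates,
  so both stay within denominators that are powers of \<pi>.\<close>

lemma generate_subset_SL2_adjoin_inverse:
  assumes "\<pi> \<noteq> 0"
  shows "generate (SL2 frac_ring) (SL2_base \<union> SL2_base_conj \<pi>) \<subseteq> carrier (SL2 (adjoin_inverse \<pi>))"
proof
  have inv: "inv\<^bsub>SL2 frac_ring\<^esub> A \<in> carrier (SL2 (adjoin_inverse \<pi>))"
    if A: "A \<in> carrier (SL2 (adjoin_inverse \<pi>))" for A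
  proof -
    obtain n a b c d where A: "A = frac_mat \<pi> n a b c d" and det: "a * d - b * c = \<pi> ^ (2 * n)"
      using A by (auto simp: carrier_SL2_adjoin_inverse[OF assms])
    have "inv\<^bsub>SL2 frac_ring\<^esub> A = frac_mat \<pi> n d (- b) (- c) a"
      unfolding A by (rule frac_mat_inv[OF assms det])
    moreover have "d * a - (- b) * (- c) = \<pi> ^ (2 * n)"
      using det by (simp add: mult.commute)
    ultimately show ?thesis
      unfolding carrier_SL2_adjoin_inverse[OF assms] by blast
  qed
  have gens: "SL2_base \<union> SL2_base_conj \<pi> \<subseteq> carrier (SL2 (adjoin_inverse \<pi>))"
  proof
    fix A assume "A \<in> SL2_base \<union> SL2_base_conj \<pi>"
    then show "A \<in> carrier (SL2 (adjoin_inverse \<pi>))"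
    proof
      assume "A \<in> SL2_base"
      then obtain a b c d where "A = frac_mat \<pi> 0 a b c d" "a * d - b * c = \<pi> ^ (2 * 0)"
        by (auto simp: SL2_base_eq[of \<pi>])
      then show ?thesis
        unfolding carrier_SL2_adjoin_inverse[OF assms] by blast
    next
      assume "A \<in> SL2_base_conj \<pi>"
      then obtain a b c d where A: "A = frac_mat \<pi> 1 (\<pi> * a) b (\<pi>\<^sup>2 * c) (\<pi> * d)" "a * d - b * c = 1"
        by (auto simp: SL2_base_conj_eq[OF assms])
      have "\<pi> * a * (\<pi> * d) - b * (\<pi>\<^sup>2 * c) = \<pi>\<^sup>2 * (a * d - b * c)"
        by (simp add: algebra_simps power2_eq_square)
      then have "\<pi> * a * (\<pi> * d) - b * (\<pi>\<^sup>2 * c) = \<pi> ^ (2 * 1)"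
        using A(2) by simp
      then show ?thesis
        unfolding carrier_SL2_adjoin_inverse[OF assms] using A(1) by blast
    qed
  qed
  fix A assume "A \<in> generate (SL2 frac_ring) (SL2_base \<union> SL2_base_conj \<pi>)"
  then show "A \<in> carrier (SL2 (adjoin_inverse \<pi>))"
  proof induction
    case one
    have "\<one>\<^bsub>SL2 frac_ring\<^esub> = frac_mat \<pi> 0 1 0 0 1" "1 * 1 - 0 * 0 = \<pi> ^ (2 * 0)"
      by (simp_all add: SL2_class_simps frac_mat_def)
    then show ?case
      unfolding carrier_SL2_adjoin_inverse[OF assms] by blast
  next
    case (eng A B)
    then obtain n a b c d m a' b' c' d'
      where A: "A = frac_mat \<pi> n a b c d" "a * d - b * c = \<pi> ^ (2 * n)"
        and B: "B = frac_mat \<pi> m a' b' c' d'" "a' * d' - b' * c' = \<pi> ^ (2 * m)"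
      by (auto simp: carrier_SL2_adjoin_inverse[OF assms])
    have "(a * a' + b * c') * (c * b' + d * d') - (a * b' + b * d') * (c * a' + d * c') =
        (a * d - b * c) * (a' * d' - b' * c')"
      by (simp add: algebra_simps)
    also have "\<dots> = \<pi> ^ (2 * (n + m))"
      by (simp add: A B power_add distrib_left)
    finally show ?case
      unfolding carrier_SL2_adjoin_inverse[OF assms] A B SL2_class_simps frac_mat_mult by blast
  qed (use gens inv in auto)
qed

text \<open>The conclusion says that \<open>N = G diag(1, \<pi>) N'\<close> with \<open>G\<close> in \<open>SL\<^sub>2(R)\<close>.\<close>

lemma transitive_mod_factor:
  assumes "prime_elem \<pi>" "transitive_mod \<pi>" "\<pi> dvd a * d - b * c"
  obtains g h i j a' b' c' d'
  where "g * j - h * i = 1" "a = g * a' + h * (\<pi> * c')" "b = g * b' + h * (\<pi> * d')"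
    "c = i * a' + j * (\<pi> * c')" "d = i * b' + j * (\<pi> * d')" "a * d - b * c = \<pi> * (a' * d' - b' * c')"
proof -
  \<comment> \<open>The rows \<open>(p, q)\<close>, \<open>(r, s)\<close> will form the inverse of
    \<open>G\<close>; the lower one has to annihilate both columns of \<open>N\<close> modulo
    \<pi>.\<close>
  have "\<exists>p q r s. p * s - q * r = 1 \<and> \<pi> dvd r * a + s * c \<and> \<pi> dvd r * b + s * d"
  proof (cases "\<pi> dvd a \<and> \<pi> dvd c")
    case True
    obtain p q r s where "p * s - q * r = 1" "\<pi> dvd r * b + s * d"
      using assms(2) unfolding transitive_mod_def by blast
    with True show ?thesis
      by (meson dvd_add dvd_mult)
  next
    case False
    obtain p q r s where pqrs: "p * s - q * r = 1" "\<pi> dvd r * a + s * c"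
      using assms(2) unfolding transitive_mod_def by blast
    \<comment> \<open>The determinant vanishes modulo \<pi>, so the columns are dependent: a row
      that annihilates the nonzero first column annihilates the second.\<close>
    have "\<pi> dvd a * (r * b + s * d)" "\<pi> dvd c * (r * b + s * d)"
    proof -
      have "a * (r * b + s * d) = b * (r * a + s * c) + s * (a * d - b * c)"
        "c * (r * b + s * d) = d * (r * a + s * c) - r * (a * d - b * c)"
        by (simp_all add: algebra_simps)
      then show "\<pi> dvd a * (r * b + s * d)" "\<pi> dvd c * (r * b + s * d)"
        using pqrs(2) assms(3) by simp_all
    qed
    then have "\<pi> dvd r * b + s * d"
      using False prime_elem_dvd_multD[OF assms(1)] by blast
    with pqrs show ?thesis by blast
  qed
  then obtain p q r s c' d' where det: "p * s - q * r = 1"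
    and c': "r * a + s * c = \<pi> * c'" and d': "r * b + s * d = \<pi> * d'"
    by (auto simp: dvd_def)
  show thesis
  proof (rule that)
    show "s * p - (- q) * (- r) = 1"
      using det by (simp add: algebra_simps)
    show "a = s * (p * a + q * c) + (- q) * (\<pi> * c')" "b = s * (p * b + q * d) + (- q) * (\<pi> * d')"
      "c = (- r) * (p * a + q * c) + p * (\<pi> * c')" "d = (- r) * (p * b + q * d) + p * (\<pi> * d')"
    proof -
      have "s * (p * a + q * c) + (- q) * (r * a + s * c) = (p * s - q * r) * a"
        "s * (p * b + q * d) + (- q) * (r * b + s * d) = (p * s - q * r) * b"
        "(- r) * (p * a + q * c) + p * (r * a + s * c) = (p * s - q * r) * c"
        "(- r) * (p * b + q * d) + p * (r * b + s * d) = (p * s - q * r) * d"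
        by (simp_all add: algebra_simps)
      then show "a = s * (p * a + q * c) + (- q) * (\<pi> * c')" "b = s * (p * b + q * d) + (- q) * (\<pi> * d')"
        "c = (- r) * (p * a + q * c) + p * (\<pi> * c')" "d = (- r) * (p * b + q * d) + p * (\<pi> * d')"
        unfolding c' d' det by simp_all
    qed
    have "(p * a + q * c) * (r * b + s * d) - (p * b + q * d) * (r * a + s * c) =
        (p * s - q * r) * (a * d - b * c)"
      by (simp add: algebra_simps)
    then show "a * d - b * c = \<pi> * ((p * a + q * c) * d' - (p * b + q * d) * c')"
      unfolding c' d' det by (simp add: algebra_simps)
  qed
qed

text \<open>Two factorisations \<open>N = G diag(1, \<pi>) G' diag(1, \<pi>) N'\<close> lower the exponent of the denominator,
  because \<open>\<pi>\<^sup>-\<^sup>1 diag(1, \<pi>) G' diag(1, \<pi>)\<close> is the product of an element of the conjugate of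
  \<open>SL\<^sub>2(R)\<close> and the Weyl element, which is absorbed in \<open>N'\<close>.\<close>

lemma frac_mat_in_generate:
  assumes "prime_elem \<pi>" "transitive_mod \<pi>" "a * d - b * c = \<pi> ^ (2 * n)"
  shows "frac_mat \<pi> n a b c d \<in> generate (SL2 frac_ring) (SL2_base \<union> SL2_base_conj \<pi>)"
  using assms(3)
proof (induction n arbitrary: a b c d)
  case 0
  then have "frac_mat \<pi> 0 a b c d \<in> SL2_base"
    by (auto simp: SL2_base_eq[of \<pi>])
  then show ?case
    by (blast intro: generate.incl)
next
  case (Suc n)
  let ?H = "generate (SL2 frac_ring) (SL2_base \<union> SL2_base_conj \<pi>)"
  have \<pi>: "\<pi> \<noteq> 0"
    using assms(1) by auto
  have "\<pi> dvd a * d - b * c"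
    unfolding Suc.prems by simp
  from transitive_mod_factor[OF assms(1,2) this]
  obtain g h i j a' b' c' d' where G: "g * j - h * i = 1"
    and N: "a = g * a' + h * (\<pi> * c')" "b = g * b' + h * (\<pi> * d')"
      "c = i * a' + j * (\<pi> * c')" "d = i * b' + j * (\<pi> * d')"
    and det1: "a * d - b * c = \<pi> * (a' * d' - b' * c')"
    by metis
  have det1: "a' * d' - b' * c' = \<pi> * \<pi> ^ (2 * n)"
    using det1 Suc.prems \<pi> by simp
  then have "\<pi> dvd a' * d' - b' * c'"
    by simp
  from transitive_mod_factor[OF assms(1,2) this]
  obtain g' h' i' j' a'' b'' c'' d'' where G': "g' * j' - h' * i' = 1"
    and N': "a' = g' * a'' + h' * (\<pi> * c'')" "b' = g' * b'' + h' * (\<pi> * d'')"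
      "c' = i' * a'' + j' * (\<pi> * c'')" "d' = i' * b'' + j' * (\<pi> * d'')"
    and det2: "a' * d' - b' * c' = \<pi> * (a'' * d'' - b'' * c'')"
    by metis
  have "a'' * d'' - b'' * c'' = \<pi> ^ (2 * n)"
    using det1 unfolding det2 mult_cancel_left using \<pi> by simp
  \<comment> \<open>The Weyl element with rows \<open>(0, 1)\<close>, \<open>(- 1, 0)\<close> is
    applied to the remaining factor; it preserves the determinant.\<close>
  then have "c'' * (- b'') - d'' * (- a'') = \<pi> ^ (2 * n)"
    by (simp add: algebra_simps)
  then have 1: "frac_mat \<pi> n c'' d'' (- a'') (- b'') \<in> ?H"
    by (rule Suc.IH)
  \<comment> \<open>The product of
    \<open>\<pi>\<^sup>-\<^sup>1 diag(1, \<pi>) G' diag(1, \<pi>)\<close> and the inverse Weyl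
    element is the conjugate of the matrix with rows \<open>(h', - g')\<close>,
    \<open>(j', - i')\<close>.\<close>
  have "h' * (- i') - (- g') * j' = 1"
    using G' by (simp add: algebra_simps)
  then have "frac_mat \<pi> 1 (\<pi> * h') (- g') (\<pi>\<^sup>2 * j') (\<pi> * (- i')) \<in> SL2_base_conj \<pi>"
    unfolding SL2_base_conj_eq[OF \<pi>] by blast
  then have 2: "frac_mat \<pi> 1 (\<pi> * h') (- g') (\<pi>\<^sup>2 * j') (\<pi> * (- i')) \<in> ?H"
    by (blast intro: generate.incl)
  have "frac_mat \<pi> 0 g h i j \<in> SL2_base"
    using G by (auto simp: SL2_base_eq[of \<pi>])
  then have 3: "frac_mat \<pi> 0 g h i j \<in> ?H"
    by (blast intro: generate.incl)
  have "frac_mat \<pi> 0 g h i j \<star> (frac_mat \<pi> 1 (\<pi> * h') (- g') (\<pi>\<^sup>2 * j') (\<pi> * (- i')) \<star>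
      frac_mat \<pi> n c'' d'' (- a'') (- b'')) \<in> ?H"
    using generate.eng[OF 3 generate.eng[OF 2 1]] by (simp add: SL2_class_simps)
  also have "frac_mat \<pi> 0 g h i j \<star> (frac_mat \<pi> 1 (\<pi> * h') (- g') (\<pi>\<^sup>2 * j') (\<pi> * (- i')) \<star>
      frac_mat \<pi> n c'' d'' (- a'') (- b'')) = frac_mat \<pi> (Suc n) a b c d"
    unfolding frac_mat_mult N N' by (simp add: algebra_simps power2_eq_square)
  finally show ?case .
qed


section \<open>From generation to transitivity\<close>

text \<open>The elements \<open>p\<^sub>0 q\<^sub>1 p\<^sub>1 \<dots> q\<^sub>k p\<^sub>k\<close> and \<open>q\<^sub>1 p\<^sub>1 \<dots> q\<^sub>k p\<^sub>k\<close> of the group generated by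
  \<open>SL\<^sub>2(R)\<close> and its conjugate, with \<open>p\<^sub>i\<close> in the former and \<open>q\<^sub>i\<close> in the latter, such that
  no factor except possibly \<open>p\<^sub>k\<close> lies in the intersection of the two.\<close>

inductive base_word and conj_word for \<pi> :: "'a::idom" where
  base: "a * d - b * c = 1 \<Longrightarrow> base_word \<pi> (frac_mat \<pi> 0 a b c d)"
| base_mult: "\<lbrakk>conj_word \<pi> m; a * d - b * c = 1; \<not> \<pi> dvd c\<rbrakk> \<Longrightarrow> base_word \<pi> (frac_mat \<pi> 0 a b c d \<star> m)"
| conj_mult: "\<lbrakk>base_word \<pi> m; a * d - b * c = 1; \<not> \<pi> dvd b\<rbrakk>
    \<Longrightarrow> conj_word \<pi> (frac_mat \<pi> 1 (\<pi> * a) b (\<pi>\<^sup>2 * c) (\<pi> * d) \<star> m)"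

text \<open>Ping-pong: up to powers of \<open>\<pi>\<close>, the two types of words are told apart by the row in which
  \<open>\<pi>\<close> has its lowest order.\<close>

lemma word_rows:
  assumes "prime_elem \<pi>"
  shows "base_word \<pi> m \<Longrightarrow> \<exists>n a b c d. m = frac_mat \<pi> n a b c d \<and> \<not> (\<pi> dvd c \<and> \<pi> dvd d)"
    and "conj_word \<pi> m \<Longrightarrow>
      \<exists>n a b c d. m = frac_mat \<pi> n a b c d \<and> \<pi> dvd c \<and> \<pi> dvd d \<and> \<not> (\<pi> dvd a \<and> \<pi> dvd b)"
proof (induction rule: base_word_conj_word.inducts)
  case (base a d b c)
  have "\<not> (\<pi> dvd c \<and> \<pi> dvd d)"
  proof
    assume "\<pi> dvd c \<and> \<pi> dvd d"
    then have "\<pi> dvd a * d - b * c" by simp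
    then show False
      using base prime_elem_not_unit[OF assms] by simp
  qed
  then show ?case by blast
next
  case (base_mult m a d b c)
  then obtain n a' b' c' d' where m: "m = frac_mat \<pi> n a' b' c' d'"
    "\<pi> dvd c'" "\<pi> dvd d'" "\<not> (\<pi> dvd a' \<and> \<pi> dvd b')"
    by blast
  \<comment> \<open>Modulo \<pi> the new lower row is \<open>c\<close> times
    \<open>(a', b')\<close>, and \<open>c\<close> is nonzero.\<close>
  have "\<not> (\<pi> dvd c * a' + d * c' \<and> \<pi> dvd c * b' + d * d')"
    using m(2-4) base_mult by (simp add: dvd_add_left_iff prime_elem_dvd_mult_iff[OF assms])
  then show ?case
    unfolding m(1) frac_mat_mult by blast
next
  case (conj_mult m a d b c)
  then obtain n a' b' c' d' where m: "m = frac_mat \<pi> n a' b' c' d'" "\<not> (\<pi> dvd c' \<and> \<pi> dvd d')"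
    by blast
  \<comment> \<open>Modulo \<pi> the new upper row is \<open>b\<close> times
    \<open>(c', d')\<close>, and \<open>b\<close> is nonzero.\<close>
  have "\<not> (\<pi> dvd \<pi> * a * a' + b * c' \<and> \<pi> dvd \<pi> * a * b' + b * d')"
    using m(2) conj_mult by (simp add: dvd_add_right_iff prime_elem_dvd_mult_iff[OF assms] mult.assoc)
  moreover have "\<pi> dvd \<pi>\<^sup>2 * c * a' + \<pi> * d * c'" "\<pi> dvd \<pi>\<^sup>2 * c * b' + \<pi> * d * d'"
    by (simp_all add: power2_eq_square mult.assoc)
  ultimately show ?case
    unfolding m(1) frac_mat_mult by blast
qed

section \<open>Left multiplication of words by generators\<close>

lemma conj_frac_mat_mult:
  assumes "\<pi> \<noteq> 0"
  shows "frac_mat \<pi> 1 (\<pi> * a) b (\<pi>\<^sup>2 * c) (\<pi> * d) \<star> frac_mat \<pi> 1 (\<pi> * a') b' (\<pi>\<^sup>2 * c') (\<pi> * d') =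
    frac_mat \<pi> 1 (\<pi> * (a * a' + b * c')) (a * b' + b * d') (\<pi>\<^sup>2 * (c * a' + d * c')) (\<pi> * (c * b' + d * d'))"
  unfolding frac_mat_mult frac_mat_eq_iff[OF assms]
  by (simp add: algebra_simps power2_eq_square)

text \<open>With determinant 1 these are the elements common to \<open>SL\<^sub>2(R)\<close> and its
  conjugate, an Iwahori subgroup: conjugation moves a factor \<pi> from the upper right entry to the
  lower left one.\<close>

lemma conj_eq_base:
  assumes "\<pi> \<noteq> 0"
  shows "frac_mat \<pi> 1 (\<pi> * a) (\<pi> * b) (\<pi>\<^sup>2 * c) (\<pi> * d) = frac_mat \<pi> 0 a b (\<pi> * c) d"
  unfolding frac_mat_eq_iff[OF assms] by (simp add: power2_eq_square)

lemma not_dvd_diagonal: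
  fixes \<pi> :: "'a::idom"
  assumes "prime_elem \<pi>" "a * d - b * c = 1" "\<pi> dvd b \<or> \<pi> dvd c"
  shows "\<not> \<pi> dvd a" "\<not> \<pi> dvd d"
proof -
  have "\<not> \<pi> dvd a * d"
  proof
    assume "\<pi> dvd a * d"
    then have "\<pi> dvd a * d - b * c"
      using assms(3) by (intro dvd_diff) auto
    then show False
      using assms(2) prime_elem_not_unit[OF assms(1)] by simp
  qed
  then show "\<not> \<pi> dvd a" "\<not> \<pi> dvd d" by auto
qed

text \<open>The diagonal entries are nonzero modulo \<pi>, so a first letter outside the
  intersection stays outside when it absorbs an element of the intersection.\<close>

lemma iwahori_word:
  assumes "prime_elem \<pi>" "a * d - b * (\<pi> * c) = 1"
  shows "base_word \<pi> m \<Longrightarrow> base_word \<pi> (frac_mat \<pi> 0 a b (\<pi> * c) d \<star> m)"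
    and "conj_word \<pi> m \<Longrightarrow> conj_word \<pi> (frac_mat \<pi> 0 a b (\<pi> * c) d \<star> m)"
proof -
  have \<pi>: "\<pi> \<noteq> 0" using assms(1) by auto
  have nd: "\<not> \<pi> dvd a" "\<not> \<pi> dvd d"
    using not_dvd_diagonal[OF assms] by auto
  show "base_word \<pi> (frac_mat \<pi> 0 a b (\<pi> * c) d \<star> m)" if "base_word \<pi> m"
    using that
  proof cases
    case (base a' d' b' c')
    then show ?thesis
      using base_word_conj_word.base[OF det_mult_eq_1[OF assms(2) base(2)], of \<pi>] by (simp add: frac_mat_mult)
  next
    case (base_mult m' a' d' b' c')
    have "\<not> \<pi> dvd \<pi> * c * a' + d * c'"
      using base_mult nd by (simp add: dvd_add_right_iff prime_elem_dvd_mult_iff[OF assms(1)] mult.assoc)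
    from base_word_conj_word.base_mult[OF base_mult(2) det_mult_eq_1[OF assms(2) base_mult(3)] this]
    show ?thesis
      unfolding base_mult(1) mat2_mult_class_assoc[symmetric] frac_mat_mult by simp
  qed
  show "conj_word \<pi> (frac_mat \<pi> 0 a b (\<pi> * c) d \<star> m)" if "conj_word \<pi> m"
    using that
  proof cases
    case (conj_mult m' a' d' b' c')
    \<comment> \<open>To merge with a letter of the conjugate, the matrix is read as the conjugate
      of the one with rows \<open>(a, \<pi> * b)\<close>, \<open>(c, d)\<close>.\<close>
    have "a * d - (\<pi> * b) * c = 1"
      using assms(2) by (simp add: algebra_simps)
    note det = det_mult_eq_1[OF this conj_mult(3)]
    have "\<not> \<pi> dvd a * b' + \<pi> * b * d'"
      using conj_mult nd by (simp add: dvd_add_left_iff prime_elem_dvd_mult_iff[OF assms(1)] mult.assoc)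
    from base_word_conj_word.conj_mult[OF conj_mult(2) det this]
    show ?thesis
      unfolding conj_mult(1) mat2_mult_class_assoc[symmetric] conj_eq_base[OF \<pi>, symmetric]
        conj_frac_mat_mult[OF \<pi>] .
  qed
qed

text \<open>The factor is merged with a first letter from \<open>SL\<^sub>2(R)\<close>, if there is
  one. If the result falls into the intersection and a \<open>conj_word\<close> follows, that word
  absorbs it.\<close>

lemma word_mult_base:
  assumes "prime_elem \<pi>" "a * d - b * c = 1" "base_word \<pi> m \<or> conj_word \<pi> m"
  shows "base_word \<pi> (frac_mat \<pi> 0 a b c d \<star> m) \<or> conj_word \<pi> (frac_mat \<pi> 0 a b c d \<star> m)"
proof -
  have conj: "base_word \<pi> (frac_mat \<pi> 0 a b c d \<star> m) \<or> conj_word \<pi> (frac_mat \<pi> 0 a b c d \<star> m)"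
    if "a * d - b * c = 1" "conj_word \<pi> m" for a b c d m
  proof (cases "\<pi> dvd c")
    case True
    then show ?thesis
      using that iwahori_word[OF assms(1)] by (auto simp: dvd_def)
  qed (use that in \<open>blast intro: base_word_conj_word.base_mult\<close>)
  from assms(3) show ?thesis
  proof
    assume "base_word \<pi> m"
    then show ?thesis
    proof cases
      case (base a' d' b' c')
      then show ?thesis
        using base_word_conj_word.base[OF det_mult_eq_1[OF assms(2) base(2)], of \<pi>] by (simp add: frac_mat_mult)
    next
      case (base_mult m' a' d' b' c')
      from conj[OF det_mult_eq_1[OF assms(2) base_mult(3)] base_mult(2)]
      show ?thesis
        unfolding base_mult(1) mat2_mult_class_assoc[symmetric] frac_mat_mult by simp
    qed
  qed (rule conj[OF assms(2)])
qed

text \<open>The same argument with the two groups exchanged; here \<pi> dividing \<open>b\<close> is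
  the condition for lying in the intersection.\<close>

lemma word_mult_conj:
  assumes "prime_elem \<pi>" "a * d - b * c = 1" "base_word \<pi> m \<or> conj_word \<pi> m"
  shows "base_word \<pi> (frac_mat \<pi> 1 (\<pi> * a) b (\<pi>\<^sup>2 * c) (\<pi> * d) \<star> m) \<or>
    conj_word \<pi> (frac_mat \<pi> 1 (\<pi> * a) b (\<pi>\<^sup>2 * c) (\<pi> * d) \<star> m)"
proof -
  have \<pi>: "\<pi> \<noteq> 0" using assms(1) by auto
  have base: "base_word \<pi> (frac_mat \<pi> 1 (\<pi> * a) b (\<pi>\<^sup>2 * c) (\<pi> * d) \<star> m) \<or>
      conj_word \<pi> (frac_mat \<pi> 1 (\<pi> * a) b (\<pi>\<^sup>2 * c) (\<pi> * d) \<star> m)"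
    if det: "a * d - b * c = 1" and m: "base_word \<pi> m" for a b c d m
  proof (cases "\<pi> dvd b")
    case True
    then obtain b' where b: "b = \<pi> * b'" by (auto simp: dvd_def)
    have "a * d - b' * (\<pi> * c) = 1"
      using det unfolding b by (simp add: algebra_simps)
    then show ?thesis
      using iwahori_word(1)[OF assms(1) _ m] unfolding b conj_eq_base[OF \<pi>] by blast
  qed (use that in \<open>blast intro: base_word_conj_word.conj_mult\<close>)
  from assms(3) show ?thesis
  proof
    assume "conj_word \<pi> m"
    then show ?thesis
    proof cases
      case (conj_mult m' a' d' b' c')
      from base[OF det_mult_eq_1[OF assms(2) conj_mult(3)] conj_mult(2)]
      show ?thesis
        unfolding conj_mult(1) mat2_mult_class_assoc[symmetric] conj_frac_mat_mult[OF \<pi>] .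
    qed
  qed (rule base[OF assms(2)])
qed

text \<open>The identity is a word, and left multiplication by generators and their inverses turns
  words into words.\<close>

lemma generate_word:
  assumes "prime_elem \<pi>" "m \<in> generate (SL2 frac_ring) (SL2_base \<union> SL2_base_conj \<pi>)"
  shows "base_word \<pi> m \<or> conj_word \<pi> m"
proof -
  have \<pi>: "\<pi> \<noteq> 0" using assms(1) by auto
  have gen: "base_word \<pi> (g \<star> m) \<or> conj_word \<pi> (g \<star> m)"
    if "g \<in> SL2_base \<union> SL2_base_conj \<pi>" "base_word \<pi> m \<or> conj_word \<pi> m" for g m
    using that word_mult_base[OF assms(1) _ that(2)] word_mult_conj[OF assms(1) _ that(2)]
    unfolding SL2_base_eq[of \<pi>] SL2_base_conj_eq[OF \<pi>] by blast
  have inv: "inv\<^bsub>SL2 frac_ring\<^esub> g \<in> SL2_base \<union> SL2_base_conj \<pi>"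
    if "g \<in> SL2_base \<union> SL2_base_conj \<pi>" for g
    using that
  proof
    assume "g \<in> SL2_base"
    then obtain a b c d where g: "g = frac_mat \<pi> 0 a b c d" "a * d - b * c = 1"
      by (auto simp: SL2_base_eq[of \<pi>])
    then have "inv\<^bsub>SL2 frac_ring\<^esub> g = frac_mat \<pi> 0 d (- b) (- c) a"
      by (simp add: frac_mat_inv[OF \<pi>])
    moreover have "d * a - (- b) * (- c) = 1"
      using g by (simp add: mult.commute)
    ultimately show ?thesis
      unfolding SL2_base_eq[of \<pi>] by blast
  next
    assume "g \<in> SL2_base_conj \<pi>"
    then obtain a b c d where g: "g = frac_mat \<pi> 1 (\<pi> * a) b (\<pi>\<^sup>2 * c) (\<pi> * d)" "a * d - b * c = 1"
      by (auto simp: SL2_base_conj_eq[OF \<pi>])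
    have "\<pi> * a * (\<pi> * d) - b * (\<pi>\<^sup>2 * c) = \<pi>\<^sup>2 * (a * d - b * c)"
      by (simp add: algebra_simps power2_eq_square)
    then have "\<pi> * a * (\<pi> * d) - b * (\<pi>\<^sup>2 * c) = \<pi> ^ (2 * 1)"
      using g(2) by simp
    then have "inv\<^bsub>SL2 frac_ring\<^esub> g = frac_mat \<pi> 1 (\<pi> * d) (- b) (\<pi>\<^sup>2 * (- c)) (\<pi> * a)"
      unfolding g(1) by (simp only: frac_mat_inv[OF \<pi>] mult_minus_right)
    moreover have "d * a - (- b) * (- c) = 1"
      using g by (simp add: mult.commute)
    ultimately show ?thesis
      unfolding SL2_base_conj_eq[OF \<pi>] by blast
  qed
  \<comment> \<open>The right factor \<open>k\<close> is arbitrary because \<open>generate\<close>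
    is closed under products of any two members, so that the induction has to act with a whole
    product.\<close>
  have "base_word \<pi> (m \<star> k) \<or> conj_word \<pi> (m \<star> k)" if "base_word \<pi> k \<or> conj_word \<pi> k" for k
    using assms(2) that
  proof (induction arbitrary: k)
    case one
    then show ?case
      by (cases k) (simp add: SL2_class_simps)
  next
    case (eng g h)
    then show ?case
      by (simp add: SL2_class_simps mat2_mult_class_assoc)
  qed (use gen inv in auto)
  from this[OF disjI1, OF base_word_conj_word.base[of 1 1 0 0]]
  show ?thesis
    by (cases m) (simp add: frac_mat_def)
qed

text \<open>An exponent \<open>n\<close> above 1 would make \<pi> divide both \<open>a'\<close> and
  \<open>b'\<close>. For \<open>n\<close> at most 1, the row \<open>(c, d)\<close> is
  \<open>(c', d')\<close> or \<pi> times it.\<close>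

lemma dvd_of_frac_mat_eq:
  assumes "prime_elem \<pi>" "frac_mat \<pi> 1 a b c d = frac_mat \<pi> n a' b' c' d'"
    and "\<pi> dvd c'" "\<pi> dvd d'" "\<not> (\<pi> dvd a' \<and> \<pi> dvd b')"
  shows "\<pi> dvd c" "\<pi> dvd d"
proof -
  have \<pi>: "\<pi> \<noteq> 0" using assms(1) by auto
  have eqs: "\<pi> ^ n * a = \<pi> * a'" "\<pi> ^ n * b = \<pi> * b'" "\<pi> ^ n * c = \<pi> * c'" "\<pi> ^ n * d = \<pi> * d'"
    using assms(2) by (auto simp: frac_mat_eq_iff[OF \<pi>])
  have "\<pi> dvd c \<and> \<pi> dvd d"
  proof (cases n)
    case 0
    with eqs show ?thesis by simp
  next
    case (Suc k)
    with eqs \<pi> have eqs': "\<pi> ^ k * a = a'" "\<pi> ^ k * b = b'" "\<pi> ^ k * c = c'" "\<pi> ^ k * d = d'"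
      by (auto simp: mult.assoc)
    have "k = 0"
    proof (rule ccontr)
      assume "k \<noteq> 0"
      then have "\<pi> dvd \<pi> ^ k" by (simp add: dvd_power)
      then show False
        using assms(5) eqs' by auto
    qed
    then show ?thesis
      using eqs' assms by simp
  qed
  then show "\<pi> dvd c" "\<pi> dvd d" by auto
qed

text \<open>The witness is the transvection \<open>1 + \<pi>\<^sup>-\<^sup>1 v w\<close> with the column \<open>v = (x, y)\<close> and the row
  \<open>w = (-y, x)\<close>; the first letter of its word moves the line of \<open>(1, 0)\<close> modulo \<open>\<pi>\<close> to that of \<open>v\<close>.\<close>

lemma transitive_mod_if_generate:
  assumes "prime_elem \<pi>"
    and gen: "carrier (SL2 (adjoin_inverse \<pi>)) \<subseteq> generate (SL2 frac_ring) (SL2_base \<union> SL2_base_conj \<pi>)"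
  shows "transitive_mod \<pi>"
  unfolding transitive_mod_def
proof (intro allI)
  fix x y :: 'a
  have \<pi>: "\<pi> \<noteq> 0" using assms(1) by auto
  show "\<exists>a b c d. a * d - b * c = 1 \<and> \<pi> dvd c * x + d * y"
  proof (cases "\<pi> dvd x \<and> \<pi> dvd y")
    case True
    then show ?thesis
      by (intro exI[of _ 1] exI[of _ 0]) simp
  next
    case False
    let ?M = "frac_mat \<pi> 1 (\<pi> - x * y) (x * x) (- y * y) (\<pi> + x * y)"
    \<comment> \<open>The row \<open>(c, d)\<close> times the numerator of \<open>?M\<close> is
      \<pi> times \<open>(c, d)\<close> plus \<open>c * x + d * y\<close> times
      \<open>(- y, x)\<close>, and the latter row is nonzero modulo \<pi>.\<close>
    have row: "\<pi> dvd c * x + d * y"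
      if "\<pi> dvd c * (\<pi> - x * y) + d * (- y * y)" "\<pi> dvd c * (x * x) + d * (\<pi> + x * y)" for c d
    proof -
      have "y * (c * x + d * y) = \<pi> * c - (c * (\<pi> - x * y) + d * (- y * y))"
        "x * (c * x + d * y) = (c * (x * x) + d * (\<pi> + x * y)) - \<pi> * d"
        by (simp_all add: algebra_simps)
      then have "\<pi> dvd y * (c * x + d * y)" "\<pi> dvd x * (c * x + d * y)"
        using that by simp_all
      then show ?thesis
        using False prime_elem_dvd_multD[OF assms(1)] by blast
    qed
    have "(\<pi> - x * y) * (\<pi> + x * y) - (x * x) * (- y * y) = \<pi> ^ (2 * 1)"
      by (simp add: algebra_simps power2_eq_square)
    then have "?M \<in> carrier (SL2 (adjoin_inverse \<pi>))"
      unfolding carrier_SL2_adjoin_inverse[OF \<pi>] by blast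
    then have "base_word \<pi> ?M \<or> conj_word \<pi> ?M"
      using gen generate_word[OF assms(1)] by blast
    then show ?thesis
    proof
      assume "base_word \<pi> ?M"
      then show ?thesis
      proof cases
        \<comment> \<open>A single letter from \<open>SL\<^sub>2(R)\<close> has entries in
          \<open>R\<close>, which would make \<pi> divide the squares of \<open>x\<close> and
          \<open>y\<close>.\<close>
        case (base a d b c)
        then have "x * x = \<pi> * b" "- y * y = \<pi> * c"
          by (simp_all add: frac_mat_eq_iff[OF \<pi>])
        then have "\<pi> dvd x * x" "\<pi> dvd y * y"
          by (metis dvd_triv_left, metis dvd_triv_left dvd_minus_iff mult_minus_left)
        then show ?thesis
          using False prime_elem_dvd_multD[OF assms(1)] by blast
      next
        case (base_mult m a d b c)
        obtain n a' b' c' d' where m: "m = frac_mat \<pi> n a' b' c' d'"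
          "\<pi> dvd c'" "\<pi> dvd d'" "\<not> (\<pi> dvd a' \<and> \<pi> dvd b')"
          using word_rows(2)[OF assms(1) base_mult(2)] by blast
        have det: "d * a - (- b) * (- c) = 1"
          using base_mult(3) by (simp add: mult.commute)
        \<comment> \<open>Cancelling the first letter leaves a \<open>conj_word\<close>, whose lower
          row is divisible by \<pi>; thus \<open>row\<close> applies to the lower row
          \<open>(- c, a)\<close> of the inverse letter.\<close>
        have "frac_mat \<pi> 0 d (- b) (- c) a \<star> (frac_mat \<pi> 0 a b c d \<star> m) =
            frac_mat \<pi> 0 (a * d - b * c) 0 0 (a * d - b * c) \<star> m"
          unfolding mat2_mult_class_assoc[symmetric] frac_mat_mult by (simp add: algebra_simps)
        also have "\<dots> = m"
          unfolding base_mult(3) by (cases m) (simp add: frac_mat_def)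
        finally have "frac_mat \<pi> 0 d (- b) (- c) a \<star> ?M = frac_mat \<pi> n a' b' c' d'"
          unfolding base_mult(1) m(1) .
        then have "\<pi> dvd (- c) * (\<pi> - x * y) + a * (- y * y)" "\<pi> dvd (- c) * (x * x) + a * (\<pi> + x * y)"
          unfolding frac_mat_mult add_0 by (rule dvd_of_frac_mat_eq[OF assms(1) _ m(2-4)])+
        then have "\<pi> dvd (- c) * x + a * y"
          by (rule row)
        with det show ?thesis by blast
      qed
    next
      assume "conj_word \<pi> ?M"
      then obtain n a' b' c' d' where m: "?M = frac_mat \<pi> n a' b' c' d'"
        "\<pi> dvd c'" "\<pi> dvd d'" "\<not> (\<pi> dvd a' \<and> \<pi> dvd b')"
        using word_rows(2)[OF assms(1)] by blast
      \<comment> \<open>Here the lower row of \<open>?M\<close> itself is divisible by \<pi>, so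
        \<open>row\<close> is used with \<open>(0, 1)\<close>.\<close>
      have "\<pi> dvd 0 * x + 1 * y"
        using dvd_of_frac_mat_eq[OF assms(1) m] by (intro row) simp_all
      then show ?thesis
        by (intro exI[of _ 1] exI[of _ 0]) simp
    qed
  qed
qed

theorem theorem3p4:
  fixes \<pi> :: "'a::idom"
  assumes "prime_elem \<pi>"
    and "(\<Inter>n::nat. range (\<lambda>r. \<pi> ^ n * r)) = {0}"
  shows "carrier (SL2 (adjoin_inverse \<pi>)) = generate (SL2 frac_ring) (SL2_base \<union> SL2_base_conj \<pi>)
    \<longleftrightarrow>
      bezout_domain (residue_ring_at \<pi>) \<and>
      map_mat2 (residue_class \<pi>) ` carrier (SL2 base_ring) = carrier (SL2 (residue_ring_at \<pi>))"
proof -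
  have \<pi>: "\<pi> \<noteq> 0" using assms(1) by auto
  have "carrier (SL2 (adjoin_inverse \<pi>)) = generate (SL2 frac_ring) (SL2_base \<union> SL2_base_conj \<pi>)
      \<longleftrightarrow> transitive_mod \<pi>"
  proof
    assume "transitive_mod \<pi>"
    then have "carrier (SL2 (adjoin_inverse \<pi>)) \<subseteq> generate (SL2 frac_ring) (SL2_base \<union> SL2_base_conj \<pi>)"
      unfolding carrier_SL2_adjoin_inverse[OF \<pi>] by (auto intro: frac_mat_in_generate[OF assms(1)])
    then show "carrier (SL2 (adjoin_inverse \<pi>)) = generate (SL2 frac_ring) (SL2_base \<union> SL2_base_conj \<pi>)"
      using generate_subset_SL2_adjoin_inverse[OF \<pi>] by blast
  qed (use transitive_mod_if_generate[OF assms(1)] in auto)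
  moreover have "transitive_mod \<pi> \<longleftrightarrow> bezout_domain (residue_ring_at \<pi>) \<and>
      map_mat2 (residue_class \<pi>) ` carrier (SL2 base_ring) = carrier (SL2 (residue_ring_at \<pi>))"
    using transitive_mod_if_bezout_lift[OF assms(1)] bezout_lift_if_transitive_mod[OF assms(1)]
      residue_domain[OF assms(1)]
    unfolding bezout_domain_def by blast
  ultimately show ?thesis by blast
qed

end
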